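(* For every integer $t\ge2$ there is a constant $C_t$ depending only on $t$ such that for all positive integers $n$, \[\operatorname{fldim}_t(\mathbf{n})\ge \log_{\sqrt{e}\,t} n - C_t,\] where $\mathbf{n}$ is the $n$-element chain.
   Context: $\mathbf{m}$ denotes the $m$-element chain. A partial function $f$ from a poset $P$ to $\mathbf{t}$ is monotone if $x\le y$ with $x,y\in\operatorname{dom}(f)$ implies $f(x)\le f(y)$. A fractional local $t$-realiser of a finite poset $P$ is a function $w$ assigning a nonnegative weight to each monotone partial function $f$ from $P$ to $\mathbf{t}$ such that for every pair $x\not\ge y$, $\sum\{w(f): x,y\in\operatorname{dom}(f),\ f(x)<f(y)\}\ge1$. The fractional local $t$-dimension $\operatorname{fldim}_t(P)$ is the minimum over all fractional local $t$-realisers $w$ of $\max_{x\in P}\sum_{f:\,x\in\operatorname{dom}(f)}w(f)$. *)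

theory Defs
  imports "HOL-Analysis.Analysis"
begin

text \<open>
  A poset is a set \<open>P\<close> of elements of a type of class \<open>order\<close>, with the induced order.
\<close>

abbreviation chain :: "nat \<Rightarrow> nat set" where
  "chain m \<equiv> {..<m}"

definition mono_pfuns :: "nat \<Rightarrow> 'a::order set \<Rightarrow> ('a \<rightharpoonup> nat) set" where
  "mono_pfuns t P =
     {f. dom f \<subseteq> P \<and> ran f \<subseteq> chain t \<and> mono_on (dom f) (\<lambda>x. the (f x))}"

text \<open>Only the values of \<open>w\<close> on \<^term>\<open>mono_pfuns t P\<close> matter.\<close>

definition frac_local_realiser ::
    "nat \<Rightarrow> 'a::order set \<Rightarrow> (('a \<rightharpoonup> nat) \<Rightarrow> real) \<Rightarrow> bool" where
  "frac_local_realiser t P w \<longleftrightarrow>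
     (\<forall>f \<in> mono_pfuns t P. w f \<ge> 0) \<and>
     (\<forall>x \<in> P. \<forall>y \<in> P. \<not> x \<ge> y \<longrightarrow>
        (\<Sum>f | f \<in> mono_pfuns t P \<and> x \<in> dom f \<and> y \<in> dom f \<and> the (f x) < the (f y). w f) \<ge> 1)"

definition max_load :: "nat \<Rightarrow> 'a::order set \<Rightarrow> (('a \<rightharpoonup> nat) \<Rightarrow> real) \<Rightarrow> real" where
  "max_load t P w = Max ((\<lambda>x. \<Sum>f | f \<in> mono_pfuns t P \<and> x \<in> dom f. w f) ` P)"

text \<open>
  The infimum below is a minimum for finite nonempty \<open>P\<close> and \<open>t \<ge> 2\<close>; see \<open>fldim_attained\<close>.
\<close>

definition fldim :: "nat \<Rightarrow> 'a::order set \<Rightarrow> real" where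
  "fldim t P = Inf {max_load t P w | w. frac_local_realiser t P w}"

lemma finite_mono_pfuns:
  assumes "finite P" shows "finite (mono_pfuns t P)"
proof -
  have "mono_pfuns t P \<subseteq> (\<Union>A\<in>Pow P. {f. dom f = A \<and> ran f \<subseteq> chain t})"
    by (auto simp: mono_pfuns_def)
  moreover have "finite (\<Union>A\<in>Pow P. {f. dom f = A \<and> ran f \<subseteq> chain t})"
    using assms by (auto intro!: finite_set_of_finite_maps intro: finite_subset)
  ultimately show ?thesis by (rule finite_subset)
qed

lemma frac_local_realiser_one:
  fixes P :: "'a::order set"
  assumes "finite P" "t \<ge> 2" shows "frac_local_realiser t P (\<lambda>_. 1)"
  unfolding frac_local_realiser_def
proof (intro conjI ballI impI)
  fix x y assume xy: "x \<in> P" "y \<in> P" "\<not> x \<ge> y"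
  let ?S = "{f \<in> mono_pfuns t P. x \<in> dom f \<and> y \<in> dom f \<and> the (f x) < the (f y)}"
  have ne: "x \<noteq> y" using xy by auto
  have "[x \<mapsto> 0, y \<mapsto> 1] \<in> ?S"
    using xy ne assms(2) by (auto simp: mono_pfuns_def mono_on_def ran_def)
  then have "?S \<noteq> {}" by (rule ex_in_conv[THEN iffD1, OF exI])
  moreover have "finite ?S" using finite_mono_pfuns[OF assms(1)] by simp
  ultimately have "0 < card ?S" by (subst card_gt_0_iff) (rule conjI)
  then have "1 \<le> real (card ?S)" by linarith
  then show "1 \<le> (\<Sum>f\<in>?S. 1::real)" by (subst real_of_card[symmetric])
qed simp

lemma max_load_mono:
  assumes "finite P" "P \<noteq> {}" "\<And>f. f \<in> mono_pfuns t P \<Longrightarrow> v f \<le> w f"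
  shows "max_load t P v \<le> max_load t P w"
proof -
  have "(\<Sum>f | f \<in> mono_pfuns t P \<and> x \<in> dom f. v f) \<le> max_load t P w" if "x \<in> P" for x
  proof -
    have "(\<Sum>f | f \<in> mono_pfuns t P \<and> x \<in> dom f. v f)
        \<le> (\<Sum>f | f \<in> mono_pfuns t P \<and> x \<in> dom f. w f)"
      by (intro sum_mono) (simp add: assms)
    also have "\<dots> \<le> max_load t P w"
      unfolding max_load_def using that assms(1) by (intro Max_ge) auto
    finally show ?thesis .
  qed
  then show ?thesis unfolding max_load_def[of t P v] using assms by (simp add: Max_le_iff)
qed

lemma continuous_on_Max_image:
  fixes g :: "'b \<Rightarrow> 'c::topological_space \<Rightarrow> real"
  assumes "finite P" "P \<noteq> {}" "\<And>x. x \<in> P \<Longrightarrow> continuous_on K (g x)"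
  shows "continuous_on K (\<lambda>w. Max ((\<lambda>x. g x w) ` P))"
  using assms
proof (induction rule: finite_ne_induct)
  case (insert x F)
  have "(\<lambda>w. Max ((\<lambda>x. g x w) ` insert x F)) = (\<lambda>w. max (g x w) (Max ((\<lambda>x. g x w) ` F)))"
    using insert by (simp add: Max_insert)
  then show ?case using insert by (simp add: continuous_on_max)
qed simp

lemma frac_local_realiser_truncate:
  assumes "finite P" "frac_local_realiser t P w"
  shows "frac_local_realiser t P (\<lambda>f. max 0 (min 1 (w f)))"
  unfolding frac_local_realiser_def
proof (intro conjI ballI impI)
  fix x y assume xy: "x \<in> P" "y \<in> P" "\<not> x \<ge> y"
  let ?S = "{f \<in> mono_pfuns t P. x \<in> dom f \<and> y \<in> dom f \<and> the (f x) < the (f y)}"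
  let ?v = "\<lambda>f. max 0 (min 1 (w f))"
  have fin: "finite ?S" using finite_mono_pfuns[OF assms(1)] by simp
  show "1 \<le> sum ?v ?S"
  proof (cases "\<exists>f\<in>?S. w f \<ge> 1")
    case True
    then obtain f where f: "f \<in> ?S" "w f \<ge> 1" by blast
    have "?v f \<le> sum ?v ?S" by (rule member_le_sum[OF f(1)]) (use fin in auto)
    then show ?thesis using f by simp
  next
    case False
    have "?v f = w f" if "f \<in> ?S" for f
    proof -
      have "w f \<ge> 0" using that assms(2) by (auto simp: frac_local_realiser_def)
      moreover have "w f < 1" using False that by force
      ultimately show ?thesis by simp
    qed
    then have "sum ?v ?S = sum w ?S" by (intro sum.cong) auto
    then show ?thesis using assms(2) xy by (simp add: frac_local_realiser_def)
  qed
qed simp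

theorem fldim_attained:
  fixes P :: "'a::order set"
  assumes "finite P" "P \<noteq> {}" "t \<ge> 2"
  obtains w where "frac_local_realiser t P w" "max_load t P w = fldim t P"
    "\<And>v. frac_local_realiser t P v \<Longrightarrow> fldim t P \<le> max_load t P v"
proof -
  let ?B = "PiE UNIV (\<lambda>_. {0..1}) :: (('a \<rightharpoonup> nat) \<Rightarrow> real) set"
  let ?R = "{w. frac_local_realiser t P w}"
  have "compactin (product_topology (\<lambda>_::'a \<rightharpoonup> nat. euclidean :: real topology) UNIV) ?B"
    by (subst compactin_PiE) (auto simp: compactin_euclidean_iff)
  then have cB: "compact ?B"
    by (simp add: euclidean_product_topology compactin_euclidean_iff)
  have co: "continuous_on A (\<lambda>w::('a \<rightharpoonup> nat) \<Rightarrow> real. w f)" for A f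
    by (rule continuous_on_subset[OF continuous_on_product_coordinates]) simp
  have clR: "closed ?R"
    unfolding frac_local_realiser_def Ball_def
    by (intro closed_Collect_conj closed_Collect_all closed_Collect_imp closed_Collect_le
        continuous_on_sum continuous_on_const co open_Collect_const)
  have cK: "compact (?B \<inter> ?R)" using cB clR by (rule compact_Int_closed)
  have "(\<lambda>_. 1) \<in> ?B \<inter> ?R" using frac_local_realiser_one[OF assms(1,3)] by auto
  then have ne: "?B \<inter> ?R \<noteq> {}" by (metis empty_iff)
  have "continuous_on (?B \<inter> ?R) (max_load t P)"
    unfolding max_load_def
    by (intro continuous_on_Max_image assms continuous_on_sum co)
  from continuous_attains_inf[OF cK ne this] obtain w where
    w: "w \<in> ?B \<inter> ?R" "\<And>v. v \<in> ?B \<inter> ?R \<Longrightarrow> max_load t P w \<le> max_load t P v" by blast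
  have min: "max_load t P w \<le> max_load t P v" if v: "frac_local_realiser t P v" for v
  proof -
    have "(\<lambda>f. max 0 (min 1 (v f))) \<in> ?B \<inter> ?R"
      using frac_local_realiser_truncate[OF assms(1) v] by auto
    then have "max_load t P w \<le> max_load t P (\<lambda>f. max 0 (min 1 (v f)))" by (rule w(2))
    also have "\<dots> \<le> max_load t P v"
      using v by (intro max_load_mono assms) (auto simp: frac_local_realiser_def)
    finally show ?thesis .
  qed
  have "fldim t P = max_load t P w"
    unfolding fldim_def by (rule cInf_eq_minimum) (use w(1) min in auto)
  then show ?thesis using that w(1) min by auto
qed

end

theory Submission
  imports Defs
begin

text \<open>
  Give the pair \<open>x < y\<close> of the chain the weight \<open>1/(y - x)\<close>; the total weight is \<open>n H\<^sub>n - n\<close>, where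
  \<open>H\<close> denotes harmonic numbers. A monotone partial function whose domain has \<open>L\<close> elements and
  whose level sets have \<open>a\<^sub>0, \<dots>, a\<^sub>t\<^sub>-\<^sub>1\<close> elements separates pairs of total weight at most
  \<open>L H\<^sub>L - (\<Sum>c. a\<^sub>c H\<^bsub>a\<^sub>c\<^esub>) \<le> (\<Sum>c. a\<^sub>c ln (L/a\<^sub>c)) \<le> L ln t\<close>, the extremal case being consecutive
  intervals. Double counting now bounds the average load of a realiser from below by
  \<open>(H\<^sub>n - 1) / ln t\<close>, which is even stronger than the claim: the base of the logarithm can be
  taken to be \<open>t\<close>.
\<close>

text \<open>Elements are added to \<open>A\<close> from the top down. Each new minimum
  \<open>b\<close> has all of the current \<open>A\<close>, all of \<open>B\<close> and
  \<open>y\<close> itself above it and at most \<open>y\<close>, so its distance to \<open>y\<close>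
  is at least \<open>card A + card B + 1\<close>. The reciprocals of these bounds form a segment of
  the harmonic sum.\<close>

lemma sum_inverse_dist_above_le:
  fixes A B :: "nat set"
  assumes "finite A" "finite B" "\<And>x z. x \<in> A \<Longrightarrow> z \<in> B \<Longrightarrow> x < z"
    "\<And>x. x \<in> A \<Longrightarrow> x < y" "\<And>z. z \<in> B \<Longrightarrow> z < y"
  shows "(\<Sum>x\<in>A. 1 / (real y - real x)) \<le> harm (card A + card B) - harm (card B)"
  using assms(1,3,4)
proof (induction A rule: finite_linorder_min_induct)
  case (insert b A)
  have "insert y (A \<union> B) \<subseteq> {b<..y}"
    using insert assms(5) by force
  then have "card (insert y (A \<union> B)) \<le> y - b"
    using card_mono[of "{b<..y}" "insert y (A \<union> B)"] by simp
  moreover have "card (insert y (A \<union> B)) = Suc (card A + card B)"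
  proof -
    have "y \<notin> A \<union> B" "A \<inter> B = {}" using insert.prems assms(5) by blast+
    then show ?thesis using insert.hyps assms(2) by (simp add: card_Un_disjoint)
  qed
  moreover have "b < y" using insert.prems by simp
  ultimately have "real (Suc (card A + card B)) \<le> real y - real b" by linarith
  then have "1 / (real y - real b) \<le> 1 / real (Suc (card A + card B))"
    by (intro divide_left_mono) auto
  moreover have "(\<Sum>x\<in>A. 1 / (real y - real x)) \<le> harm (card A + card B) - harm (card B)"
    using insert by blast
  moreover have "b \<notin> A" using insert.hyps by blast
  ultimately show ?case using insert.hyps by (simp add: harm_Suc inverse_eq_divide)
qed simp

text \<open>\<open>B\<close> grows upwards. When a new top \<open>y\<close> arrives, the old
  \<open>B\<close> lies between \<open>A\<close> and \<open>y\<close>, so the previous lemma bounds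
  its contribution. Adjacent intervals give equality.\<close>

lemma sum_inverse_dist_separated_le:
  fixes A B :: "nat set"
  assumes "finite A" "finite B" "\<And>x y. x \<in> A \<Longrightarrow> y \<in> B \<Longrightarrow> x < y"
  shows "(\<Sum>y\<in>B. \<Sum>x\<in>A. 1 / (real y - real x))
    \<le> real (card A + card B) * harm (card A + card B)
        - real (card A) * harm (card A) - real (card B) * harm (card B)"
  using assms(2,3)
proof (induction B rule: finite_linorder_max_induct)
  case (insert y B)
  \<comment> \<open>The increment of k H(k) is H(k) + 1. Used at \<open>card A + card B\<close> and
    at \<open>card B\<close>, the two ones cancel and leave exactly the harmonic difference
    contributed by \<open>y\<close>.\<close>
  have step: "real (Suc k) * harm (Suc k) = real k * harm k + harm k + (1::real)" for k
    by (simp add: harm_Suc field_simps del: of_nat_Suc) (simp add: algebra_simps)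
  have "(\<Sum>x\<in>A. 1 / (real y - real x)) \<le> harm (card A + card B) - harm (card B)"
    using insert assms(1) by (intro sum_inverse_dist_above_le) auto
  moreover have "y \<notin> B" using insert.hyps by blast
  moreover have "(\<Sum>y\<in>B. \<Sum>x\<in>A. 1 / (real y - real x))
      \<le> real (card A + card B) * harm (card A + card B)
        - real (card A) * harm (card A) - real (card B) * harm (card B)"
    using insert by blast
  ultimately show ?case
    using insert.hyps step[of "card A + card B"] step[of "card B"] by simp
qed simp

text \<open>Induction on the number of levels: by monotonicity the new level \<open>?B\<close> lies
  entirely above the union \<open>?A\<close> of the lower ones, and the terms for \<open>?A\<close>
  telescope.\<close>

lemma sum_inverse_dist_levels_le:
  fixes D :: "nat set" and v :: "nat \<Rightarrow> nat"
  assumes "finite D" "mono_on D v"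
  shows "(\<Sum>y | y \<in> D \<and> v y < t. \<Sum>x | x \<in> D \<and> v x < v y. 1 / (real y - real x))
    \<le> real (card {x\<in>D. v x < t}) * harm (card {x\<in>D. v x < t})
        - (\<Sum>c<t. real (card {x\<in>D. v x = c}) * harm (card {x\<in>D. v x = c}))"
proof (induction t)
  case (Suc t)
  let ?A = "{x\<in>D. v x < t}" and ?B = "{x\<in>D. v x = t}"
  have split: "{x\<in>D. v x < Suc t} = ?A \<union> ?B" by auto
  have disj: "?A \<inter> ?B = {}" by auto
  have card: "card {x\<in>D. v x < Suc t} = card ?A + card ?B"
    unfolding split using assms(1) disj by (intro card_Un_disjoint) auto
  have less: "x < y" if "x \<in> ?A" "y \<in> ?B" for x y
    using that mono_onD[OF assms(2), of y x] by force
  have "(\<Sum>y | y \<in> D \<and> v y < Suc t. \<Sum>x | x \<in> D \<and> v x < v y. 1 / (real y - real x))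
      = (\<Sum>y\<in>?A. \<Sum>x | x \<in> D \<and> v x < v y. 1 / (real y - real x))
        + (\<Sum>y\<in>?B. \<Sum>x | x \<in> D \<and> v x < v y. 1 / (real y - real x))"
    unfolding split using assms(1) disj by (intro sum.union_disjoint) auto
  moreover have "(\<Sum>y\<in>?B. \<Sum>x | x \<in> D \<and> v x < v y. 1 / (real y - real x))
      = (\<Sum>y\<in>?B. \<Sum>x\<in>?A. 1 / (real y - real x))"
    by (intro sum.cong) auto
  moreover have "(\<Sum>y\<in>?B. \<Sum>x\<in>?A. 1 / (real y - real x))
      \<le> real (card ?A + card ?B) * harm (card ?A + card ?B)
        - real (card ?A) * harm (card ?A) - real (card ?B) * harm (card ?B)"
    using assms(1) less by (intro sum_inverse_dist_separated_le) auto
  ultimately show ?case unfolding card sum.lessThan_Suc using Suc.IH by linarith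
qed simp

lemma harm_diff_le_ln:
  assumes "1 \<le> a" "a \<le> b"
  shows "harm b - harm a \<le> ln (real b / real a)"
  using assms(2)
proof (induction b rule: dec_induct)
  case (step b)
  have b: "real b > 0" using step assms(1) by simp
  \<comment> \<open>The inequality ln u \<le> u - 1 at u = b/(b+1) yields 1/(b+1) \<le> ln
    ((b+1)/b); these logarithms telescope.\<close>
  have "ln (real b / real (Suc b)) \<le> real b / real (Suc b) - 1"
    using b by (intro ln_le_minus_one) simp
  also have "\<dots> = - inverse (real (Suc b))" by (simp add: field_simps)
  finally have "inverse (real (Suc b)) \<le> ln (real (Suc b)) - ln (real b)"
    using b by (simp add: ln_div del: of_nat_Suc)
  then show ?case
    using step.IH b assms(1) by (simp add: harm_Suc ln_div del: of_nat_Suc)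
qed (use assms in simp)

lemma sum_inverse_dist_mono_le:
  fixes D :: "nat set" and v :: "nat \<Rightarrow> nat"
  assumes "finite D" "mono_on D v" "v ` D \<subseteq> {..<t}" "t \<ge> 1"
  shows "(\<Sum>y\<in>D. \<Sum>x | x \<in> D \<and> v x < v y. 1 / (real y - real x)) \<le> ln (real t) * real (card D)"
proof -
  define a where "a c = card {x\<in>D. v x = c}" for c
  define L where "L = card D"
  have D: "{x\<in>D. v x < t} = D" using assms(3) by auto
  have aL: "a c \<le> L" for c unfolding a_def L_def using assms(1) by (intro card_mono) auto
  have "L = (\<Sum>c<t. a c)"
    unfolding L_def a_def using sum.group[OF assms(1) _ assms(3), of "\<lambda>_. 1::nat"] by simp
  then have L: "real L = (\<Sum>c<t. real (a c))" by simp
  have "(\<Sum>y\<in>D. \<Sum>x | x \<in> D \<and> v x < v y. 1 / (real y - real x))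
      \<le> real L * harm L - (\<Sum>c<t. real (a c) * harm (a c))"
    using sum_inverse_dist_levels_le[OF assms(1,2), of t] by (simp add: D L_def a_def)
  also have "\<dots> = (\<Sum>c<t. real (a c) * (harm L - harm (a c)))"
    by (subst L) (simp add: sum_distrib_right right_diff_distrib sum_subtractf)
  \<comment> \<open>This is the bound of entropy by its value at the uniform distribution, proved
    termwise: ln u \<le> u - 1 at u = L/(t a(c)) produces the correction L/t - a(c), and these
    corrections sum to zero over the \<open>t\<close> levels.\<close>
  also have "\<dots> \<le> (\<Sum>c<t. real (a c) * ln (real t) + (real L / real t - real (a c)))"
  proof (rule sum_mono)
    fix c
    show "real (a c) * (harm L - harm (a c))
      \<le> real (a c) * ln (real t) + (real L / real t - real (a c))"
    \<comment> \<open>An empty level is treated apart because the logarithm of L/a(c) is meaningful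
      only for a(c) > 0; there the left side is 0 and the right side is L/t.\<close>
    proof (cases "a c = 0")
      case False
      then have pos: "real (a c) > 0" "real L > 0" "real t > 0" using aL[of c] assms(4) by auto
      have "harm L - harm (a c) \<le> ln (real L / real (a c))"
        using False aL by (intro harm_diff_le_ln) auto
      also have "\<dots> = ln (real t) + ln (real L / (real t * real (a c)))"
        using pos by (simp add: ln_div ln_mult)
      also have "\<dots> \<le> ln (real t) + (real L / (real t * real (a c)) - 1)"
        using pos by (intro add_left_mono ln_le_minus_one) simp
      finally have "harm L - harm (a c) \<le> ln (real t) + (real L / (real t * real (a c)) - 1)" .
      then have "real (a c) * (harm L - harm (a c))
          \<le> real (a c) * (ln (real t) + (real L / (real t * real (a c)) - 1))"
        using pos by (intro mult_left_mono) auto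
      also have "\<dots> = real (a c) * ln (real t) + (real L / real t - real (a c))"
        using pos by (simp add: field_simps)
      finally show ?thesis .
    qed simp
  qed
  also have "\<dots> = ln (real t) * real L"
    using assms(4) by (simp add: sum.distrib sum_subtractf L[symmetric] sum_distrib_right[symmetric])
  finally show ?thesis by (simp add: L_def)
qed

text \<open>The distances from y down to the smaller elements are exactly 1, ..., y, so row y
  contributes H(y), which is the increment of k H(k) - k at k = y.\<close>

lemma sum_inverse_dist_chain:
  "(\<Sum>y<n. \<Sum>x<y. 1 / (real y - real x)) = real n * harm n - real n"
proof (induction n)
  case (Suc n)
  have "(\<Sum>x<n. 1 / (real n - real x)) = (\<Sum>k=1..n. inverse (real k))"
    by (rule sum.reindex_bij_witness[of _ "\<lambda>k. n - k" "\<lambda>x. n - x"])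
      (auto simp: of_nat_diff inverse_eq_divide)
  then have "(\<Sum>x<n. 1 / (real n - real x)) = harm n" by (simp add: harm_def)
  moreover have "real (Suc n) * harm (Suc n) = real (Suc n) * harm n + 1"
    by (simp add: harm_Suc distrib_left del: of_nat_Suc)
  ultimately show ?case using Suc by (simp add: algebra_simps)
qed (simp add: harm_def)

lemma max_load_chain_ge:
  assumes w: "frac_local_realiser t (chain n) w" and "t \<ge> 1" "n \<ge> 1"
  shows "harm n - 1 \<le> ln (real t) * max_load t (chain n) w"
proof -
  let ?F = "mono_pfuns t (chain n)"
  let ?g = "\<lambda>x y. 1 / (real y - real x)"
  let ?sep = "\<lambda>f x y. x \<in> dom f \<and> y \<in> dom f \<and> the (f x) < the (f y)"
  have fin: "finite ?F" by (rule finite_mono_pfuns) simp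
  have w0: "w f \<ge> 0" if "f \<in> ?F" for f using w that by (simp add: frac_local_realiser_def)
  have sep1: "1 \<le> (\<Sum>f | f \<in> ?F \<and> ?sep f x y. w f)" if "x < y" "y < n" for x y
    using w that by (simp add: frac_local_realiser_def)
  have "real n * harm n - real n = (\<Sum>y<n. \<Sum>x<y. ?g x y)"
    by (rule sum_inverse_dist_chain[symmetric])
  \<comment> \<open>Every pair \<open>x < y\<close> is separated with total weight at least
    1.\<close>
  also have "\<dots> \<le> (\<Sum>y<n. \<Sum>x<y. ?g x y * (\<Sum>f | f \<in> ?F \<and> ?sep f x y. w f))"
    using sep1 by (intro sum_mono) (simp add: divide_right_mono)
  also have "\<dots> = (\<Sum>y<n. \<Sum>x<y. \<Sum>f\<in>?F. w f * (if ?sep f x y then ?g x y else 0))"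
    by (intro sum.cong refl, subst sum.inter_filter[OF fin], subst sum_distrib_left, intro sum.cong) auto
  also have "\<dots> = (\<Sum>f\<in>?F. \<Sum>y<n. \<Sum>x<y. w f * (if ?sep f x y then ?g x y else 0))"
    by (simp only: sum.swap[where B = ?F])
  also have "\<dots> \<le> (\<Sum>f\<in>?F. w f * (ln (real t) * real (card (dom f))))"
  proof (rule sum_mono)
    fix f assume f: "f \<in> ?F"
    let ?v = "\<lambda>x. the (f x)"
    have dom: "dom f \<subseteq> {..<n}" and mono: "mono_on (dom f) ?v" and ran: "?v ` dom f \<subseteq> {..<t}"
      using f by (auto simp: mono_pfuns_def ran_def)
    have fd: "finite (dom f)" using dom finite_subset by blast
    have less: "x < y" if "?sep f x y" for x y
      using that mono_onD[OF mono, of y x] by (cases "x < y") auto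
    have eq: "{x\<in>{..<y}. ?sep f x y} = (if y \<in> dom f then {x. x \<in> dom f \<and> ?v x < ?v y} else {})" for y
      using less by (cases "y \<in> dom f") (simp_all add: set_eq_iff, metis)
    have "(\<Sum>y<n. \<Sum>x<y. if ?sep f x y then ?g x y else 0)
        = (\<Sum>y<n. if y \<in> dom f then \<Sum>x | x \<in> dom f \<and> ?v x < ?v y. ?g x y else 0)"
      by (intro sum.cong refl) (subst sum.inter_filter[symmetric], simp, subst eq, simp)
    also have "\<dots> = (\<Sum>y\<in>dom f. \<Sum>x | x \<in> dom f \<and> ?v x < ?v y. ?g x y)"
      using dom by (simp add: sum.inter_restrict[symmetric] Int_absorb1)
    also have "\<dots> \<le> ln (real t) * real (card (dom f))"
      using fd mono ran assms(2) by (rule sum_inverse_dist_mono_le)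
    finally show "(\<Sum>y<n. \<Sum>x<y. w f * (if ?sep f x y then ?g x y else 0))
        \<le> w f * (ln (real t) * real (card (dom f)))"
      unfolding sum_distrib_left[symmetric] using w0[OF f] by (rule mult_left_mono)
  qed
  \<comment> \<open>Spreading each \<open>w f\<close> over the points of \<open>dom f\<close> turns
    weighted domain sizes into loads, each at most the maximal load.\<close>
  also have "\<dots> = ln (real t) * (\<Sum>f\<in>?F. \<Sum>x<n. if x \<in> dom f then w f else 0)"
    unfolding sum_distrib_left
  proof (rule sum.cong[OF refl])
    fix f assume "f \<in> ?F"
    then have "dom f \<subseteq> {..<n}" by (auto simp: mono_pfuns_def)
    then have "(\<Sum>x<n. if x \<in> dom f then w f else 0) = real (card (dom f)) * w f"
      by (simp add: sum.inter_restrict[symmetric] Int_absorb1)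
    then show "w f * (ln (real t) * real (card (dom f)))
        = (\<Sum>x<n. ln (real t) * (if x \<in> dom f then w f else 0))"
      by (simp add: sum_distrib_left[symmetric])
  qed
  also have "\<dots> = ln (real t) * (\<Sum>x<n. \<Sum>f | f \<in> ?F \<and> x \<in> dom f. w f)"
    by (subst sum.swap) (simp only: sum.inter_filter[OF fin])
  also have "\<dots> \<le> ln (real t) * (\<Sum>x<n. max_load t (chain n) w)"
    unfolding max_load_def using assms(2) by (intro mult_left_mono sum_mono Max_ge) auto
  finally have "real n * (harm n - 1) \<le> real n * (ln (real t) * max_load t (chain n) w)"
    by (simp add: algebra_simps)
  then show ?thesis using assms(3) by simp
qed

theorem theorem11:
  fixes t :: nat
  assumes "t \<ge> 2"
  shows "\<exists>C::real. \<forall>n::nat. n \<ge> 1 \<longrightarrow>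
           fldim t (chain n) \<ge> log (sqrt (exp 1) * real t) (real n) - C"
proof (intro exI[of _ "1 / ln (real t)"] allI impI)
  fix n :: nat assume n: "n \<ge> 1"
  have t: "ln (real t) > 0" using assms by simp
  have "chain n \<noteq> {}" using n by (auto simp: lessThan_empty_iff)
  then obtain w where w: "frac_local_realiser t (chain n) w" "max_load t (chain n) w = fldim t (chain n)"
    using fldim_attained[of "chain n" t] assms by blast
  have "ln (real n) \<le> ln (real n + 1)" using n by simp
  also have "\<dots> \<le> harm n" by (rule ln_le_harm)
  finally have "ln (real n) - 1 \<le> ln (real t) * fldim t (chain n)"
    using max_load_chain_ge[OF w(1)] w(2) assms n by simp
  \<comment> \<open>Division by \<open>ln t\<close> turns the 1 subtracted from
    \<open>harm n\<close> into the constant of the theorem.\<close>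
  then have "ln (real n) / ln (real t) - 1 / ln (real t) \<le> fldim t (chain n)"
    using t by (simp add: field_simps)
  \<comment> \<open>Since \<open>ln n\<close> is nonnegative, enlarging the base from
    \<open>t\<close> only decreases the logarithm.\<close>
  moreover have "log (sqrt (exp 1) * real t) (real n) \<le> ln (real n) / ln (real t)"
  proof -
    have "ln (sqrt (exp 1) * real t) \<ge> ln (real t)"
      using assms by (simp add: ln_mult ln_sqrt)
    then show ?thesis unfolding log_def using t n by (intro divide_left_mono) auto
  qed
  ultimately show "log (sqrt (exp 1) * real t) (real n) - 1 / ln (real t) \<le> fldim t (chain n)"
    by simp
qed

end
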